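(* Let $V$ be a real Hilbert space with dual $V^\star$ and dual pairing $\langle\cdot,\cdot\rangle$. Let $A : V \to V^\star$ be linear, bounded and coercive, i.e., there exist $c, C > 0$ with $c\,\|v\|_V^2 \le \langle A v, v\rangle \le C\,\|v\|_V^2$ for all $v \in V$. Let $j : V \to (-\infty,\infty]$ be proper, convex, lower semicontinuous and positively homogeneous of degree one, i.e., $j(\alpha v) = \alpha j(v)$ for all $v \in V$, $\alpha > 0$. For $f \in V^\star$ let $S(f) \in V$ denote the unique solution $y$ of $$\text{Find } y \in V: \quad \langle A y - f, v - y\rangle + j(v) - j(y) \ge 0 \quad \forall v \in V,$$ and let $T(f) \in V^\star$ denote the unique solution $q$ of $$\text{Find } q \in \partial j(0): \quad \langle p - q, A^{-1}(q - f)\rangle \ge 0 \quad \forall p \in \partial j(0).$$ Let $f \in V^\star$ be given, and set $y := S(f)$, $q := T(f)$. Suppose that the set $\partial j(0) \subset V^\star$ is polyhedric at $q$ with respect to $y \in V \cong V^{\star\star}$. Then the solution operator $S : V^\star \to V$ is Hadamard directionally differentiable in $f$ in all directions $g \in V^\star$, and the directional derivative $\delta := S'(f;g)$ in $f$ in a direction $g$ is uniquely characterized by the variational inequality $$\text{Find } \delta \in \bigl(\mathcal{T}_{\partial j(0)}(q) \cap y^\perp\bigr)^\circ: \quad \langle A\delta - g, v - \delta\rangle \ge 0 \quad \forall v \in \bigl(\mathcal{T}_{\partial j(0)}(q) \cap y^\perp\bigr)^\circ .$$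
   Context: $\partial j(0) = \{p \in V^\star \mid \langle p, v\rangle \le j(v) \ \forall v \in V\}$ is the convex subdifferential of $j$ at $0$ (note $j(0)=0$); it is non-empty, closed and convex, and both variational inequalities are uniquely solvable for every $f \in V^\star$. For a closed, convex, non-empty subset $K$ of a Banach space $W$ and $w \in K$, let $\mathcal{R}_K(w) := \mathbb{R}^+(K - w)$, $\mathcal{T}_K(w) := \overline{\mathcal{R}_K(w)}$ and $\mathcal{N}_K(w) := \mathcal{T}_K(w)^\circ$ be the radial, tangent and normal cone, where for a cone $C \subset W$ the polar cone is $C^\circ = \{\eta \in W^\star \mid \langle \eta, h\rangle \le 0 \ \forall h \in C\}$. For $\eta \in W^\star$, $\eta^\perp \subset W$ denotes the kernel of $\eta$. $K$ is polyhedric at $w \in K$ with respect to $\eta \in \mathcal{N}_K(w)$ if $\mathcal{T}_K(w) \cap \eta^\perp = \overline{\mathcal{R}_K(w) \cap \eta^\perp}$. Here $W = V^\star$ and $W^\star = V^{\star\star}$ is identified with $V$, so $y^\perp \subset V^\star$ and polar cones of cones in $V^\star$ are subsets of $V$. The element $y$ always belongs to $\mathcal{N}_{\partial j(0)}(q)$. $S$ is Hadamard directionally differentiable in $f$ in direction $g$ with derivative $S'(f;g)$ if $(S(f + t_n g_n) - S(f))/t_n \to S'(f;g)$ in $V$ for all sequences $t_n \searrow 0$ and $g_n \to g$ in $V^\star$. *)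

theory Defs
  imports "HOL-Analysis.Analysis"
begin

text \<open>The dual of \<open>'a\<close> is \<open>'a \<Rightarrow>\<^sub>L real\<close>, and the dual pairing of \<open>p\<close> and \<open>v\<close> is
  \<open>blinfun_apply p v\<close>.\<close>

definition bidual_embed :: "'a::real_normed_vector \<Rightarrow> ('a \<Rightarrow>\<^sub>L real) \<Rightarrow>\<^sub>L real" where
  "bidual_embed v = Blinfun (\<lambda>p. blinfun_apply p v)"

lemma bidual_embed_apply [simp]: "blinfun_apply (bidual_embed v) p = blinfun_apply p v"
  unfolding bidual_embed_def
  by (simp add: bounded_linear_Blinfun_apply blinfun.bounded_linear_left)


definition coercive :: "('a::real_normed_vector \<Rightarrow>\<^sub>L ('a \<Rightarrow>\<^sub>L real)) \<Rightarrow> bool" where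
  "coercive A \<longleftrightarrow> (\<exists>c C. c > 0 \<and> C > 0 \<and>
     (\<forall>v. c * (norm v)\<^sup>2 \<le> blinfun_apply (blinfun_apply A v) v \<and>
          blinfun_apply (blinfun_apply A v) v \<le> C * (norm v)\<^sup>2))"

definition proper_fun :: "('a \<Rightarrow> ereal) \<Rightarrow> bool" where
  "proper_fun j \<longleftrightarrow> (\<forall>v. j v \<noteq> -\<infinity>) \<and> (\<exists>v. j v \<noteq> \<infinity>)"

definition convex_fun :: "('a::real_vector \<Rightarrow> ereal) \<Rightarrow> bool" where
  "convex_fun j \<longleftrightarrow> (\<forall>u v t. 0 \<le> t \<longrightarrow> t \<le> 1 \<longrightarrow>
     j ((1 - t) *\<^sub>R u + t *\<^sub>R v) \<le> ereal (1 - t) * j u + ereal t * j v)"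

definition lower_semicontinuous :: "('a::topological_space \<Rightarrow> ereal) \<Rightarrow> bool" where
  "lower_semicontinuous j \<longleftrightarrow> (\<forall>v. j v \<le> Liminf (at v) j)"

definition positively_homogeneous :: "('a::real_vector \<Rightarrow> ereal) \<Rightarrow> bool" where
  "positively_homogeneous j \<longleftrightarrow> (\<forall>v \<alpha>. \<alpha> > 0 \<longrightarrow> j (\<alpha> *\<^sub>R v) = ereal \<alpha> * j v)"

definition subdiff0 :: "('a::real_normed_vector \<Rightarrow> ereal) \<Rightarrow> ('a \<Rightarrow>\<^sub>L real) set" where
  "subdiff0 j = {p. \<forall>v. ereal (blinfun_apply p v) \<le> j v}"


text \<open>In \<open>ereal\<close> both \<open>r - \<infinity> = -\<infinity>\<close> and \<open>\<infinity> - \<infinity> = \<infinity>\<close> hold. So the inequality below is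
  satisfied for those \<open>v\<close> with \<open>j v = \<infinity>\<close>, and, for proper \<open>j\<close>, it forces \<open>j y\<close> to be finite.\<close>

definition solves_primal ::
  "('a::real_normed_vector \<Rightarrow>\<^sub>L ('a \<Rightarrow>\<^sub>L real)) \<Rightarrow> ('a \<Rightarrow> ereal) \<Rightarrow> ('a \<Rightarrow>\<^sub>L real) \<Rightarrow> 'a \<Rightarrow> bool" where
  "solves_primal A j f y \<longleftrightarrow>
     (\<forall>v. ereal (blinfun_apply (blinfun_apply A y - f) (v - y)) + j v - j y \<ge> 0)"

lemma solves_primal_finite:
  assumes "proper_fun j" "solves_primal A j f y"
  shows "\<bar>j y\<bar> \<noteq> \<infinity>"
proof -
  obtain v where v: "j v \<noteq> \<infinity>" "j v \<noteq> -\<infinity>" "j y \<noteq> -\<infinity>"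
    using assms(1) by (auto simp: proper_fun_def)
  have "ereal (blinfun_apply (blinfun_apply A y - f) (v - y)) + j v - j y \<ge> 0"
    using assms(2) by (auto simp: solves_primal_def)
  then show ?thesis using v by (cases "j v"; cases "j y") auto
qed

definition primal_sol ::
  "('a::real_normed_vector \<Rightarrow>\<^sub>L ('a \<Rightarrow>\<^sub>L real)) \<Rightarrow> ('a \<Rightarrow> ereal) \<Rightarrow> ('a \<Rightarrow>\<^sub>L real) \<Rightarrow> 'a" where
  "primal_sol A j f = (THE y. solves_primal A j f y)"

text \<open>A bounded coercive \<open>A\<close> on a Hilbert space is bijective (Lax-Milgram), so that
  \<open>inv (blinfun_apply A)\<close> is its genuine inverse.\<close>

definition solves_dual ::
  "('a::real_normed_vector \<Rightarrow>\<^sub>L ('a \<Rightarrow>\<^sub>L real)) \<Rightarrow> ('a \<Rightarrow> ereal) \<Rightarrow> ('a \<Rightarrow>\<^sub>L real)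
    \<Rightarrow> ('a \<Rightarrow>\<^sub>L real) \<Rightarrow> bool" where
  "solves_dual A j f q \<longleftrightarrow> q \<in> subdiff0 j \<and>
     (\<forall>p\<in>subdiff0 j. blinfun_apply (p - q) (inv (blinfun_apply A) (q - f)) \<ge> 0)"

definition dual_sol ::
  "('a::real_normed_vector \<Rightarrow>\<^sub>L ('a \<Rightarrow>\<^sub>L real)) \<Rightarrow> ('a \<Rightarrow> ereal) \<Rightarrow> ('a \<Rightarrow>\<^sub>L real)
    \<Rightarrow> ('a \<Rightarrow>\<^sub>L real)" where
  "dual_sol A j f = (THE q. solves_dual A j f q)"


definition radial_cone :: "'w::real_normed_vector set \<Rightarrow> 'w \<Rightarrow> 'w set" where
  "radial_cone K w = {t *\<^sub>R (k - w) | t k. t > 0 \<and> k \<in> K}"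

definition tangent_cone :: "'w::real_normed_vector set \<Rightarrow> 'w \<Rightarrow> 'w set" where
  "tangent_cone K w = closure (radial_cone K w)"

definition polar_cone :: "'w::real_normed_vector set \<Rightarrow> ('w \<Rightarrow>\<^sub>L real) set" where
  "polar_cone C = {\<eta>. \<forall>h\<in>C. blinfun_apply \<eta> h \<le> 0}"

definition annihilator :: "('w::real_normed_vector \<Rightarrow>\<^sub>L real) \<Rightarrow> 'w set" where
  "annihilator \<eta> = {h. blinfun_apply \<eta> h = 0}"

text \<open>The notion is meant for closed convex \<open>K\<close>, \<open>w \<in> K\<close> and \<open>\<eta>\<close> in the normal cone
  \<open>polar_cone (tangent_cone K w)\<close>; these side conditions are not part of the predicate.\<close>

definition polyhedric_at :: "'w::real_normed_vector set \<Rightarrow> 'w \<Rightarrow> ('w \<Rightarrow>\<^sub>L real) \<Rightarrow> bool" where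
  "polyhedric_at K w \<eta> \<longleftrightarrow>
     tangent_cone K w \<inter> annihilator \<eta> = closure (radial_cone K w \<inter> annihilator \<eta>)"

text \<open>The polar of \<open>tangent_cone K q \<inter> annihilator y\<close>, a set of bidual elements, pulled back
  to the space itself along the canonical embedding.\<close>

definition critical_polar ::
  "('a::real_normed_vector \<Rightarrow>\<^sub>L real) set \<Rightarrow> ('a \<Rightarrow>\<^sub>L real) \<Rightarrow> 'a \<Rightarrow> 'a set" where
  "critical_polar K q y =
     bidual_embed -` polar_cone (tangent_cone K q \<inter> annihilator (bidual_embed y))"


definition has_hadamard_derivative ::
  "('w::real_normed_vector \<Rightarrow> 'v::real_normed_vector) \<Rightarrow> 'w \<Rightarrow> 'w \<Rightarrow> 'v \<Rightarrow> bool" where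
  "has_hadamard_derivative F f g d \<longleftrightarrow>
     (\<forall>t G. (\<forall>n. t n > (0::real)) \<longrightarrow> t \<longlonglongrightarrow> 0 \<longrightarrow> G \<longlonglongrightarrow> g \<longrightarrow>
        (\<lambda>n. (F (f + t n *\<^sub>R G n) - F f) /\<^sub>R t n) \<longlonglongrightarrow> d)"

end

theory Submission
  imports Defs
begin

text \<open>The functional \<open>j\<close> is the support function of K = \<open>subdiff0 j\<close>, so \<open>y = S f\<close> is
  equivalent to \<open>q = f - A y\<close> lying in K with \<open>y\<close> in the normal cone of K at \<open>q\<close>.
  Let e and \<psi> = g' - A e be the difference quotients of y and q for the perturbation t g'
  and let \<zeta> = g - A \<delta>, which by the bipolar theorem is a critical direction. By coercivity
  e - \<delta> is controlled by \<langle>\<zeta> - \<psi>, e - \<delta>\<rangle> up to the perturbation error, and \<langle>\<zeta>, \<delta>\<rangle> = 0.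
  Polyhedricity replaces \<zeta> by a nearby radial direction h orthogonal to y; testing the perturbed
  problem with q + t h gives \<langle>h - \<psi>, e\<rangle> \<le> 0 and \<langle>\<psi>, y\<rangle> = O(t). The last term \<langle>\<psi>, \<delta>\<rangle> is
  asymptotically nonpositive because \<psi> is tangential and \<delta> is a norm limit of sums \<eta> + s y with
  \<eta> in the normal cone. This gives strong convergence without weak compactness.\<close>

section \<open>Projections and the Riesz representation\<close>

text \<open>Completeness replaces compactness: the sets of near-minimizers of the distance are
  closed and nested, and their diameters shrink by the parallelogram law, so they share a
  point.\<close>

lemma closest_point_exists_hilbert:
  fixes K :: "'a::{real_inner, complete_space} set"
  assumes "closed K" "convex K" "K \<noteq> {}"
  obtains u where "u \<in> K" "\<And>v. v \<in> K \<Longrightarrow> dist x u \<le> dist x v"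
proof -
  define d where "d = infdist x K"
  define S where "S n = K \<inter> cball x (d + 1 / real (Suc n))" for n
  have d0: "d \<ge> 0" unfolding d_def by (rule infdist_nonneg)
  have dle: "d \<le> dist x v" if "v \<in> K" for v
    unfolding d_def using that by (rule infdist_le)
  have ne: "S n \<noteq> {}" for n
  proof -
    have "infdist x K < d + 1 / real (Suc n)"
      by (simp add: d_def)
    then have "(INF a\<in>K. dist x a) < d + 1 / real (Suc n)"
      using assms(3) by (simp add: infdist_notempty)
    then obtain a where "a \<in> K" "dist x a < d + 1 / real (Suc n)"
      using assms(3) by (auto simp: cINF_less_iff)
    then show ?thesis by (auto simp: S_def intro!: exI[of _ a])
  qed
  have diam: "\<exists>n. \<forall>u\<in>S n. \<forall>v\<in>S n. dist u v < e" if e: "e > 0" for e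
  proof -
    have "(\<lambda>n. 4 * (d + 1 / real (Suc n))\<^sup>2 - 4 * d\<^sup>2) \<longlonglongrightarrow> 4 * (d + 0)\<^sup>2 - 4 * d\<^sup>2"
      by (intro tendsto_intros LIMSEQ_Suc[OF lim_1_over_n])
    then have "eventually (\<lambda>n. 4 * (d + 1 / real (Suc n))\<^sup>2 - 4 * d\<^sup>2 < e\<^sup>2) sequentially"
      using e by (intro order_tendstoD(2)) auto
    then obtain n where n: "4 * (d + 1 / real (Suc n))\<^sup>2 - 4 * d\<^sup>2 < e\<^sup>2"
      by (auto simp: eventually_sequentially)
    have "dist u v < e" if uv: "u \<in> S n" "v \<in> S n" for u v
    proof -
      define r where "r = d + 1 / real (Suc n)"
      have r: "norm (x - u) \<le> r" "norm (x - v) \<le> r"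
        using uv by (auto simp: S_def r_def dist_norm)
      \<comment> \<open>The midpoint is at distance at least \<open>d\<close> from \<open>x\<close>,
        so the parallelogram law leaves little room for \<open>dist u v\<close>.\<close>
      have "(1/2) *\<^sub>R u + (1/2) *\<^sub>R v \<in> K"
        using uv assms(2) by (intro convexD) (auto simp: S_def)
      from dle[OF this] have "d \<le> norm (x - ((1/2) *\<^sub>R u + (1/2) *\<^sub>R v))"
        by (simp add: dist_norm)
      also have "x - ((1/2) *\<^sub>R u + (1/2) *\<^sub>R v) = (1/2) *\<^sub>R ((x - u) + (x - v))"
        by (simp add: algebra_simps flip: scaleR_left_distrib)
      finally have "2 * d \<le> norm ((x - u) + (x - v))" by simp
      then have 1: "(2 * d)\<^sup>2 \<le> (norm ((x - u) + (x - v)))\<^sup>2"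
        using d0 by (intro power_mono) auto
      have "(norm (u - v))\<^sup>2 + (norm ((x - u) + (x - v)))\<^sup>2
          = 2 * (norm (x - u))\<^sup>2 + 2 * (norm (x - v))\<^sup>2"
        by (simp add: power2_norm_eq_inner algebra_simps inner_commute)
      moreover have "(norm (x - u))\<^sup>2 \<le> r\<^sup>2" "(norm (x - v))\<^sup>2 \<le> r\<^sup>2"
        using r by (auto intro!: power_mono)
      ultimately have "(norm (u - v))\<^sup>2 < e\<^sup>2"
        using 1 n by (simp add: r_def power_mult_distrib)
      then show ?thesis
        using e by (simp add: dist_norm power2_less_imp_less)
    qed
    then show ?thesis by blast
  qed
  have mono: "S n \<subseteq> S m" if "m \<le> n" for m n
    using that unfolding S_def by (intro Int_mono subset_cball order_refl add_left_mono)
      (simp add: frac_le)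
  have cl: "closed (S n)" for n
    unfolding S_def by (intro closed_Int assms closed_cball)
  obtain u where u: "\<And>n. u \<in> S n"
    using decreasing_closed_nest[of S, OF cl ne mono diam] by blast
  have "(\<lambda>n. d + 1 / real (Suc n)) \<longlonglongrightarrow> d + 0"
    by (intro tendsto_intros LIMSEQ_Suc[OF lim_1_over_n])
  then have "dist x u \<le> d"
    using u by (intro LIMSEQ_le_const[where X = "\<lambda>n. d + 1 / real (Suc n)"]) (auto simp: S_def)
  moreover have "u \<in> K" using u by (auto simp: S_def)
  ultimately show thesis using dle that by (meson order_trans)
qed

lemma projection_exists:
  fixes K :: "'a::{real_inner, complete_space} set"
  assumes "closed K" "convex K" "K \<noteq> {}"
  obtains u where "u \<in> K" "\<And>v. v \<in> K \<Longrightarrow> (x - u) \<bullet> (v - u) \<le> 0"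
proof -
  obtain u where "u \<in> K" "\<And>v. v \<in> K \<Longrightarrow> dist x u \<le> dist x v"
    using closest_point_exists_hilbert[OF assms] by metis
  then show thesis
    using that any_closest_point_dot[of K u _ x] assms by blast
qed

text \<open>Adding the two angle conditions bounds the squared norm by an inner product;
  Cauchy-Schwarz then cancels one factor.\<close>

lemma projection_nonexpansive:
  fixes p p' x x' :: "'a::real_inner"
  assumes "(x - p) \<bullet> (p' - p) \<le> 0" "(x' - p') \<bullet> (p - p') \<le> 0"
  shows "norm (p - p') \<le> norm (x - x')"
proof -
  have "norm (p - p') * norm (p - p') \<le> (x - x') \<bullet> (p - p')"
    using assms unfolding power2_eq_square[symmetric] power2_norm_eq_inner
    by (simp add: algebra_simps inner_commute)
  also have "\<dots> \<le> norm (x - x') * norm (p - p')" by (rule norm_cauchy_schwarz)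
  finally show ?thesis
    by (cases "norm (p - p') = 0") (auto simp: mult_le_cancel_right)
qed

text \<open>Projecting 0 onto the hyperplane where \<open>l\<close> equals 1 gives a vector
  \<open>u\<close> orthogonal to the kernel of \<open>l\<close>; a multiple of \<open>u\<close>
  represents \<open>l\<close>.\<close>

lemma riesz_representation:
  fixes l :: "'a::{real_inner, complete_space} \<Rightarrow>\<^sub>L real"
  obtains b where "l = blinfun_inner_left b"
proof (cases "l = 0")
  case True
  then have "l = blinfun_inner_left 0" by (auto intro!: blinfun_eqI)
  then show ?thesis by (rule that)
next
  case False
  define K where "K = {v. l v = 1}"
  obtain w where w: "l w \<noteq> 0" using False by (metis blinfun_eqI zero_blinfun.rep_eq)
  have "closed K" unfolding K_def
    by (intro closed_Collect_eq continuous_intros)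
  moreover have "convex K" unfolding K_def
    by (auto simp: convex_def blinfun.bilinear_simps)
  moreover have "w /\<^sub>R l w \<in> K" using w by (simp add: K_def blinfun.bilinear_simps)
  ultimately obtain u where "u \<in> K" "\<And>v. v \<in> K \<Longrightarrow> (0 - u) \<bullet> (v - u) \<le> 0"
    using projection_exists[of K 0] by (metis empty_iff)
  then have u: "l u = 1" "\<And>v. l v = 1 \<Longrightarrow> (0 - u) \<bullet> (v - u) \<le> 0"
    by (simp_all add: K_def)
  have orth: "u \<bullet> h = 0" if "l h = 0" for h
    using u(2)[of "u + h"] u(2)[of "u - h"] u(1) that by (simp add: blinfun.bilinear_simps)
  have "u \<noteq> 0" using u(1) by (auto simp: blinfun.bilinear_simps)
  have "l v = ((1 / (u \<bullet> u)) *\<^sub>R u) \<bullet> v" for v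
    using orth[of "v - l v *\<^sub>R u"] u(1) \<open>u \<noteq> 0\<close>
    by (simp add: blinfun.bilinear_simps inner_diff_right)
  then have "l = blinfun_inner_left ((1 / (u \<bullet> u)) *\<^sub>R u)"
    by (auto intro!: blinfun_eqI simp: inner_commute)
  then show ?thesis by (rule that)
qed

section \<open>Variational inequalities\<close>

text \<open>Only the inequalities from testing each solution with the other are assumed, so the
  lemma serves every constraint set. Their sum conflicts with coercivity unless
  \<open>u = u'\<close>.\<close>

lemma coercive_vi_unique:
  fixes a :: "'a::real_inner \<Rightarrow> 'a \<Rightarrow> real"
  assumes a: "bounded_bilinear a" and c: "c > 0" "\<And>v. c * (norm v)\<^sup>2 \<le> a v v"
    and u: "a u (u' - u) \<ge> blinfun_apply l (u' - u)"
    and u': "a u' (u - u') \<ge> blinfun_apply l (u - u')"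
  shows "u = u'"
proof -
  interpret bounded_bilinear a by (rule a)
  have "a (u - u') (u - u') \<le> 0"
    using u u' by (simp add: diff_left diff_right blinfun.bilinear_simps)
  with c(2)[of "u - u'"] have "c * (norm (u - u'))\<^sup>2 \<le> 0" by linarith
  then show ?thesis using c(1) by (simp add: mult_le_0_iff)
qed

text \<open>With \<open>a u v = B u \<bullet> v\<close> and \<open>l v = b \<bullet> v\<close>, the solution is the fixed point of
  u \<mapsto> P_K(u - \<rho> (Bu - b)), a contraction for small \<rho> > 0.\<close>

theorem stampacchia:
  fixes a :: "'a::{real_inner, complete_space} \<Rightarrow> 'a \<Rightarrow> real"
    and l :: "'a \<Rightarrow>\<^sub>L real"
  assumes a: "bounded_bilinear a" and c: "c > 0" "\<And>v. c * (norm v)\<^sup>2 \<le> a v v"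
    and K: "closed K" "convex K" "K \<noteq> {}"
  shows "\<exists>u\<in>K. \<forall>v\<in>K. a u (v - u) \<ge> l (v - u)"
proof -
  interpret bounded_bilinear a by (rule a)
  have "\<exists>b. Blinfun (a u) = blinfun_inner_left b" for u
    using riesz_representation by metis
  then obtain B where B': "\<And>u. Blinfun (a u) = blinfun_inner_left (B u)" by metis
  have B: "a u v = B u \<bullet> v" for u v
    using arg_cong[OF B', of "\<lambda>l. blinfun_apply l v" u]
    by (simp add: bounded_linear_Blinfun_apply bounded_linear_right inner_commute)
  obtain b where b: "l = blinfun_inner_left b"
    using riesz_representation by blast
  obtain M0 where M0: "\<And>u v. norm (a u v) \<le> norm u * norm v * M0"
    using bounded by blast
  \<comment> \<open>The maximum makes \<open>M\<close> positive and at least \<open>c\<close>, so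
    that the constant \<open>k\<close> below is nonnegative.\<close>
  define M where "M = max M0 c"
  have M: "M > 0" "M \<ge> c" using c(1) by (auto simp: M_def)
  have aM: "a u v \<le> norm u * norm v * M" for u v
    using M0[of u v] mult_left_mono[of M0 M "norm u * norm v"] by (simp add: M_def abs_le_iff)
  have Bbound: "norm (B u - B v) \<le> M * norm (u - v)" for u v
  proof -
    have "norm (B u - B v) * norm (B u - B v) = (B u - B v) \<bullet> (B u - B v)"
      by (simp add: power2_norm_eq_inner flip: power2_eq_square)
    also have "\<dots> = a (u - v) (B u - B v)"
      by (simp only: B[symmetric] inner_diff_left diff_left)
    also have "\<dots> \<le> (M * norm (u - v)) * norm (B u - B v)"
      using aM[of "u - v" "B u - B v"] by (simp add: mult_ac)
    finally show ?thesis
      using M by (cases "norm (B u - B v) = 0") (auto simp: mult_le_cancel_right)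
  qed
  have "\<exists>p. p \<in> K \<and> (\<forall>v\<in>K. (x - p) \<bullet> (v - p) \<le> 0)" for x
    using projection_exists[OF K] by metis
  then obtain P where P: "\<And>x. P x \<in> K" "\<And>x v. v \<in> K \<Longrightarrow> (x - P x) \<bullet> (v - P x) \<le> 0"
    by metis
  \<comment> \<open>This step size minimizes 1 - 2 r c + r^2 M^2, and the minimum is the constant
    \<open>k\<close> below.\<close>
  define r where "r = c / M\<^sup>2"
  have r: "r > 0" using c M by (simp add: r_def)
  define F where "F u = P (u - r *\<^sub>R (B u - b))" for u
  define k where "k = 1 - c\<^sup>2 / M\<^sup>2"
  have k: "0 \<le> k" "k < 1"
    using M c(1) by (auto simp: k_def divide_le_eq intro: power_mono)
  have contr: "dist (F u) (F v) \<le> sqrt k * dist u v" for u v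
  proof -
    have "dist (F u) (F v) \<le> norm ((u - r *\<^sub>R (B u - b)) - (v - r *\<^sub>R (B v - b)))"
      unfolding F_def dist_norm by (intro projection_nonexpansive P)
    also have "\<dots> = norm ((u - v) - r *\<^sub>R (B u - B v))"
      by (simp add: algebra_simps)
    also have "\<dots> \<le> sqrt (k * (norm (u - v))\<^sup>2)"
    proof (rule real_le_rsqrt)
      have "(norm ((u - v) - r *\<^sub>R (B u - B v)))\<^sup>2
          = (norm (u - v))\<^sup>2 - 2 * r * ((B u - B v) \<bullet> (u - v)) + r\<^sup>2 * (norm (B u - B v))\<^sup>2"
        by (simp add: power2_norm_eq_inner power2_eq_square[of r] inner_diff_left inner_diff_right
              inner_commute algebra_simps)
      also have "\<dots> \<le> (norm (u - v))\<^sup>2 - 2 * r * (c * (norm (u - v))\<^sup>2)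
          + r\<^sup>2 * (M * norm (u - v))\<^sup>2"
      proof -
        have "(B u - B v) \<bullet> (u - v) \<ge> c * (norm (u - v))\<^sup>2"
          using c(2)[of "u - v"] by (simp add: B[symmetric] inner_diff_left diff_left)
        then have "2 * r * ((B u - B v) \<bullet> (u - v)) \<ge> 2 * r * (c * (norm (u - v))\<^sup>2)"
          using r by (intro mult_left_mono) auto
        moreover have "r\<^sup>2 * (norm (B u - B v))\<^sup>2 \<le> r\<^sup>2 * (M * norm (u - v))\<^sup>2"
          using Bbound by (intro mult_left_mono power_mono) auto
        ultimately show ?thesis by linarith
      qed
      also have "\<dots> = (1 - 2 * r * c + r\<^sup>2 * M\<^sup>2) * (norm (u - v))\<^sup>2"
        by (simp add: algebra_simps power_mult_distrib)
      also have "1 - 2 * r * c + r\<^sup>2 * M\<^sup>2 = k"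
        using M by (simp add: r_def k_def field_simps power2_eq_square)
      finally show "(norm ((u - v) - r *\<^sub>R (B u - B v)))\<^sup>2 \<le> k * (norm (u - v))\<^sup>2" .
    qed
    also have "\<dots> = sqrt k * dist u v"
      by (simp add: real_sqrt_mult dist_norm)
    finally show ?thesis .
  qed
  have "\<exists>!u. F u = u"
    using k contr by (intro banach_fix_type[of "sqrt k"]) auto
  then obtain u where u: "F u = u" by blast
  have "u \<in> K" using P(1) u by (metis F_def)
  moreover have "a u (v - u) \<ge> l (v - u)" if "v \<in> K" for v
  proof -
    have "(u - r *\<^sub>R (B u - b) - u) \<bullet> (v - u) \<le> 0"
      using P(2)[OF that, of "u - r *\<^sub>R (B u - b)"] u by (simp add: F_def)
    then have "r * ((B u - b) \<bullet> (v - u)) \<ge> 0" by simp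
    then have "(B u - b) \<bullet> (v - u) \<ge> 0" using r by (simp add: zero_le_mult_iff)
    then show ?thesis unfolding B b by (simp add: inner_diff_left inner_commute[of b])
  qed
  ultimately show ?thesis by blast
qed

section \<open>The form induced by an operator and the Lax-Milgram theorem\<close>

lemma bounded_bilinear_blinfun_apply2:
  fixes A :: "'a::real_normed_vector \<Rightarrow>\<^sub>L ('a \<Rightarrow>\<^sub>L real)"
  shows "bounded_bilinear (\<lambda>u v. A u v)"
  by (rule bounded_bilinear.comp1[OF bounded_bilinear_blinfun_apply blinfun.bounded_linear_right])

text \<open>On the whole space, the test vectors \<open>u + v\<close> and \<open>u - v\<close> turn
  the variational inequality into an equation, which gives surjectivity; uniqueness gives
  injectivity.\<close>

corollary lax_milgram:
  fixes A :: "'a::{real_inner, complete_space} \<Rightarrow>\<^sub>L ('a \<Rightarrow>\<^sub>L real)"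
  assumes c: "c > 0" "\<And>v. c * (norm v)\<^sup>2 \<le> A v v"
  shows "bij (blinfun_apply A)"
proof (rule bijI)
  show "inj (blinfun_apply A)"
  proof (rule injI)
    fix u v assume "A u = A v"
    then show "u = v"
      using coercive_vi_unique[OF bounded_bilinear_blinfun_apply2[of A] c, where u = u and u' = v and l = "A u"]
      by simp
  qed
  show "surj (blinfun_apply A)"
    unfolding surj_def
  proof
    fix l :: "'a \<Rightarrow>\<^sub>L real"
    obtain u where u: "\<And>v. A u (v - u) \<ge> l (v - u)"
      using stampacchia[OF bounded_bilinear_blinfun_apply2[of A] c, of UNIV l] by auto
    have "A u v = l v" for v
      using u[of "u + v"] u[of "u - v"] by (simp add: blinfun.bilinear_simps)
    then show "\<exists>u. l = A u" by (metis blinfun_eqI)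
  qed
qed

section \<open>Separation and polarity\<close>

text \<open>The residual of the projection onto the cone separates: the test points 0 and 2u make it
  orthogonal to the projection u.\<close>

lemma convex_cone_separation:
  fixes D :: "'a::{real_inner, complete_space} set"
  assumes "closed D" "convex_cone D" "x \<notin> D"
  obtains z where "\<And>v. v \<in> D \<Longrightarrow> z \<bullet> v \<le> 0" "z \<bullet> x > 0"
proof -
  have D: "convex D" "conic D" "D \<noteq> {}"
    using assms(2) by (auto simp: convex_cone_def)
  obtain u where u: "u \<in> D" "\<And>v. v \<in> D \<Longrightarrow> (x - u) \<bullet> (v - u) \<le> 0"
    using projection_exists[OF assms(1) D(1,3)] by blast
  have "0 \<in> D" "2 *\<^sub>R u \<in> D"
    using D u(1) by (auto simp: conic_contains_0 intro: conicD)
  from u(2)[OF this(1)] u(2)[OF this(2)] have 0: "(x - u) \<bullet> u = 0"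
    by (simp add: inner_diff_right scaleR_2)
  have "x \<noteq> u" using u(1) assms(3) by auto
  then have "(x - u) \<bullet> (x - u) > 0" by simp
  then have "(x - u) \<bullet> x > 0" using 0 by (simp add: inner_diff_right)
  moreover have "(x - u) \<bullet> v \<le> 0" if "v \<in> D" for v
    using u(2)[OF that] 0 by (simp add: inner_diff_right)
  ultimately show thesis using that by blast
qed

text \<open>Reflexivity of the Hilbert space: the separating functional on the dual is an evaluation.\<close>

lemma convex_cone_separation_dual:
  fixes D :: "('a::{real_inner, complete_space} \<Rightarrow>\<^sub>L real) set"
  assumes "closed D" "convex_cone D" "p \<notin> D"
  obtains v where "\<And>p. p \<in> D \<Longrightarrow> p v \<le> 0" "p v > 0"
proof -
  define D' where "D' = blinfun_inner_left -` D"
  obtain x where x: "p = blinfun_inner_left x" using riesz_representation by blast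
  have lin: "linear (blinfun_inner_left :: 'a \<Rightarrow> _)"
    by (simp add: bounded_linear.linear bounded_linear_blinfun_inner_left)
  have "closed D'" unfolding D'_def
    using assms(1) by (intro closed_vimage linear_continuous_on bounded_linear_blinfun_inner_left)
  moreover have "convex_cone D'"
  proof -
    obtain d where "d \<in> D" using assms(2) by (auto simp: convex_cone_def)
    moreover obtain x where "d = blinfun_inner_left x" using riesz_representation by blast
    ultimately have "D' \<noteq> {}" by (auto simp: D'_def)
    moreover have "convex D'"
      unfolding D'_def using assms(2) lin by (intro convex_linear_vimage) (auto simp: convex_cone_def)
    moreover have "conic D'"
      using assms(2) by (auto simp: convex_cone_def conic_def D'_def linear_cmul[OF lin])
    ultimately show ?thesis by (simp add: convex_cone_def)
  qed
  moreover have "x \<notin> D'" using assms(3) x by (simp add: D'_def)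
  ultimately obtain z where z: "\<And>v. v \<in> D' \<Longrightarrow> z \<bullet> v \<le> 0" "z \<bullet> x > 0"
    using convex_cone_separation by blast
  show thesis
  proof (rule that)
    show "p z > 0" using z(2) x by (simp add: inner_commute)
    fix p' assume p': "p' \<in> D"
    obtain x' where "p' = blinfun_inner_left x'" using riesz_representation by blast
    then show "p' z \<le> 0" using z(1)[of x'] p' by (simp add: D'_def inner_commute)
  qed
qed


lemma convex_cone_closure:
  fixes S :: "'a::real_normed_vector set"
  assumes "convex_cone S"
  shows "convex_cone (closure S)"
  unfolding convex_cone_iff
proof (intro conjI ballI allI impI)
  show "0 \<in> closure S"
    using convex_cone_contains_0[OF assms] closure_subset by blast
next
  fix x y assume "x \<in> closure S" "y \<in> closure S"
  then obtain X Y where "\<And>n. X n \<in> S" "X \<longlonglongrightarrow> x" "\<And>n. Y n \<in> S" "Y \<longlonglongrightarrow> y"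
    by (auto simp: closure_sequential)
  then show "x + y \<in> closure S"
    using convex_cone_add[OF assms]
    by (auto simp: closure_sequential intro!: exI[of _ "\<lambda>n. X n + Y n"] tendsto_add)
next
  fix x and c :: real assume "x \<in> closure S" "0 \<le> c"
  then obtain X where "\<And>n. X n \<in> S" "X \<longlonglongrightarrow> x"
    by (auto simp: closure_sequential)
  then show "c *\<^sub>R x \<in> closure S"
    using convex_cone_scaleR[OF assms \<open>0 \<le> c\<close>]
    by (auto simp: closure_sequential intro!: exI[of _ "\<lambda>n. c *\<^sub>R X n"] tendsto_intros)
qed

text \<open>As \<open>e\<close> tends to 0, this says that the polar of the intersection of
  \<open>T\<close> with the annihilator of \<open>y\<close> lies in the closure of the polar of
  \<open>T\<close> plus the span of \<open>y\<close>. A vector separating \<open>d\<close> from that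
  closure represents, by the bipolar argument, an element of \<open>T\<close> that vanishes at
  \<open>y\<close>.\<close>

lemma polar_Int_annihilator_approx:
  fixes T :: "('a::{real_inner, complete_space} \<Rightarrow>\<^sub>L real) set"
  assumes T: "closed T" "convex_cone T"
    and d: "\<And>p. p \<in> T \<Longrightarrow> p y = 0 \<Longrightarrow> p d \<le> 0"
    and e: "e > 0"
  obtains \<eta> s where "\<And>p. p \<in> T \<Longrightarrow> p \<eta> \<le> 0" "norm (d - (\<eta> + s *\<^sub>R y)) < e"
proof -
  define D where "D = {\<eta> + s *\<^sub>R y | \<eta> s. \<forall>p\<in>T. p \<eta> \<le> 0}"
  have DI: "\<eta> + s *\<^sub>R y \<in> D" if "\<forall>p\<in>T. p \<eta> \<le> 0" for \<eta> s
    using that by (auto simp: D_def)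
  have "convex_cone D"
    unfolding convex_cone_iff
  proof (intro conjI ballI allI impI)
    show "0 \<in> D" using DI[of 0 0] by simp
  next
    fix v w assume "v \<in> D" "w \<in> D"
    then obtain \<eta> s \<eta>' s' where *: "v = \<eta> + s *\<^sub>R y" "w = \<eta>' + s' *\<^sub>R y"
      "\<forall>p\<in>T. p \<eta> \<le> 0" "\<forall>p\<in>T. p \<eta>' \<le> 0" by (auto simp: D_def)
    have "(\<eta> + \<eta>') + (s + s') *\<^sub>R y \<in> D"
      using * by (intro DI) (auto simp: blinfun.bilinear_simps intro: add_nonpos_nonpos)
    then show "v + w \<in> D" by (simp add: * algebra_simps)
  next
    fix v and c :: real assume "v \<in> D" "0 \<le> c"
    then obtain \<eta> s where *: "v = \<eta> + s *\<^sub>R y" "\<forall>p\<in>T. p \<eta> \<le> 0" by (auto simp: D_def)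
    have "c *\<^sub>R \<eta> + (c * s) *\<^sub>R y \<in> D"
      using * \<open>0 \<le> c\<close> by (intro DI) (auto simp: blinfun.bilinear_simps mult_nonneg_nonpos)
    then show "c *\<^sub>R v \<in> D" by (simp add: * algebra_simps)
  qed
  have "d \<in> closure D"
  proof (rule ccontr)
    assume "d \<notin> closure D"
    then obtain z where z: "\<And>v. v \<in> closure D \<Longrightarrow> z \<bullet> v \<le> 0" "z \<bullet> d > 0"
      using convex_cone_separation[of "closure D" d] convex_cone_closure[OF \<open>convex_cone D\<close>] by auto
    have zD: "z \<bullet> v \<le> 0" if "v \<in> D" for v
      using z(1) that closure_subset by blast
    have "blinfun_inner_left z \<in> T"
    proof (rule ccontr)
      assume "blinfun_inner_left z \<notin> T"
      then obtain v where v: "\<And>p. p \<in> T \<Longrightarrow> p v \<le> 0" "blinfun_inner_left z v > 0"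
        using convex_cone_separation_dual[OF T] by blast
      then show False using DI[of v 0] zD[of v] by (simp add: inner_commute)
    qed
    \<comment> \<open>Both \<open>y\<close> and \<open>- y\<close> belong to
      \<open>D\<close>.\<close>
    moreover have "z \<bullet> y = 0"
      using zD[OF DI[of 0 1]] zD[OF DI[of 0 "-1"]] by simp
    ultimately show False
      using d[of "blinfun_inner_left z"] z(2) by (simp add: inner_commute)
  qed
  then obtain v where "v \<in> D" "dist v d < e"
    using e by (auto simp: closure_approachable)
  then show thesis
    using that by (auto simp: D_def dist_norm norm_minus_commute)
qed

section \<open>Radial and tangent cones of a convex set\<close>

lemma radial_coneI: "0 < t \<Longrightarrow> k \<in> K \<Longrightarrow> t *\<^sub>R (k - w) \<in> radial_cone K w"
  by (auto simp: radial_cone_def)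

lemma radial_cone_subset_tangent_cone: "radial_cone K w \<subseteq> tangent_cone K w"
  by (simp add: tangent_cone_def closure_subset)

lemma convex_cone_radial_cone:
  assumes K: "convex K" "w \<in> K"
  shows "convex_cone (radial_cone K w)"
proof -
  have 0: "0 \<in> radial_cone K w"
    using radial_coneI[of 1 w K w] K by simp
  show ?thesis
    unfolding convex_cone_iff
  proof (intro conjI ballI allI impI 0)
    fix x y assume "x \<in> radial_cone K w" "y \<in> radial_cone K w"
    then obtain s k t l where *: "x = s *\<^sub>R (k - w)" "y = t *\<^sub>R (l - w)" "s > 0" "t > 0" "k \<in> K" "l \<in> K"
      by (auto simp: radial_cone_def)
    have "(s + t) *\<^sub>R (((s / (s + t)) *\<^sub>R k + (t / (s + t)) *\<^sub>R l) - w) \<in> radial_cone K w"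
      using * K by (intro radial_coneI convexD) (auto simp: add_divide_distrib[symmetric])
    also have "(s + t) *\<^sub>R (((s / (s + t)) *\<^sub>R k + (t / (s + t)) *\<^sub>R l) - w) = x + y"
      using * by (simp add: scaleR_diff_right scaleR_add_right) (simp add: algebra_simps)
    finally show "x + y \<in> radial_cone K w" .
  next
    fix x and c :: real assume "x \<in> radial_cone K w" "0 \<le> c"
    then obtain s k where *: "x = s *\<^sub>R (k - w)" "s > 0" "k \<in> K"
      by (auto simp: radial_cone_def)
    show "c *\<^sub>R x \<in> radial_cone K w"
      using 0 * \<open>0 \<le> c\<close> radial_coneI[of "c * s" k K w] by (cases "c = 0") auto
  qed
qed

text \<open>The ray from \<open>w\<close> along \<open>h\<close> runs through the point
  \<open>k\<close> of \<open>K\<close> that generates \<open>h\<close> and reaches it at parameter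
  \<open>1 / s\<close>; convexity covers the segment.\<close>

lemma radial_cone_add_mem:
  assumes "convex K" "w \<in> K" "h \<in> radial_cone K w"
  obtains \<tau> where "\<tau> > 0" "\<And>t. 0 \<le> t \<Longrightarrow> t \<le> \<tau> \<Longrightarrow> w + t *\<^sub>R h \<in> K"
proof -
  obtain s k where *: "h = s *\<^sub>R (k - w)" "s > 0" "k \<in> K"
    using assms(3) by (auto simp: radial_cone_def)
  have "w + t *\<^sub>R h \<in> K" if "0 \<le> t" "t \<le> 1 / s" for t
  proof -
    have "(1 - t * s) *\<^sub>R w + (t * s) *\<^sub>R k \<in> K"
      using assms * that by (intro convexD) (auto simp: field_simps)
    then show ?thesis by (simp add: * algebra_simps)
  qed
  then show thesis using that[of "1 / s"] * by simp
qed

section \<open>The polar of the critical cone\<close>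

lemma mem_critical_polar:
  "v \<in> critical_polar K q y \<longleftrightarrow> (\<forall>p\<in>tangent_cone K q. p y = 0 \<longrightarrow> p v \<le> 0)"
  by (auto simp: critical_polar_def polar_cone_def annihilator_def)

lemma closed_critical_polar: "closed (critical_polar K q y)"
proof -
  have "critical_polar K q y = (\<Inter>p\<in>{p \<in> tangent_cone K q. blinfun_apply p y = 0}. {v. blinfun_apply p v \<le> 0})"
    by (auto simp: mem_critical_polar)
  moreover have "closed {v. blinfun_apply p v \<le> (0::real)}" for p
    by (intro closed_Collect_le continuous_intros)
  ultimately show ?thesis by auto
qed

lemma convex_cone_critical_polar: "convex_cone (critical_polar K q y)"
  unfolding convex_cone_iff
  by (auto simp: mem_critical_polar blinfun.bilinear_simps mult_nonneg_nonpos
      intro: add_nonpos_nonpos)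

section \<open>The functional as support function of its subdifferential\<close>

lemma subdiff0_closed:
  assumes "\<And>v. j v \<noteq> -\<infinity>"
  shows "closed (subdiff0 j)"
proof -
  have "closed {p. ereal (blinfun_apply p v) \<le> j v}" for v
  proof (cases "j v")
    case (real r)
    then show ?thesis by (auto intro!: closed_Collect_le continuous_intros)
  qed (use assms in auto)
  then have "closed (\<Inter>v. {p. ereal (blinfun_apply p v) \<le> j v})" by blast
  moreover have "subdiff0 j = (\<Inter>v. {p. ereal (blinfun_apply p v) \<le> j v})"
    by (auto simp: subdiff0_def)
  ultimately show ?thesis by simp
qed

lemma subdiff0_convex:
  assumes "\<And>v. j v \<noteq> -\<infinity>"
  shows "convex (subdiff0 j)"
  unfolding convex_def
proof (intro ballI allI impI)
  fix p p' and u w :: real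
  assume pq: "p \<in> subdiff0 j" "p' \<in> subdiff0 j" and uw: "0 \<le> u" "0 \<le> w" "u + w = 1"
  have "ereal ((u *\<^sub>R p + w *\<^sub>R p') v) \<le> j v" for v
  proof (cases "j v")
    case (real r)
    have "ereal (p v) \<le> j v" "ereal (p' v) \<le> j v" using pq by (auto simp: subdiff0_def)
    then have "u * p v + w * p' v \<le> r"
      using real uw by (intro convex_bound_le) auto
    then show ?thesis using real by (simp add: blinfun.bilinear_simps)
  qed (use assms in auto)
  then show "u *\<^sub>R p + w *\<^sub>R p' \<in> subdiff0 j" by (simp add: subdiff0_def)
qed

lemma closed_epigraph:
  fixes j :: "'a::metric_space \<Rightarrow> ereal"
  assumes "lower_semicontinuous j"
  shows "closed {x. j (fst x) \<le> ereal (snd x)}"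
  unfolding closed_sequential_limits
proof (intro allI impI, elim conjE)
  fix X and x :: "'a \<times> real"
  assume X: "\<forall>n. X n \<in> {x. j (fst x) \<le> ereal (snd x)}" and lim: "X \<longlonglongrightarrow> x"
  show "x \<in> {x. j (fst x) \<le> ereal (snd x)}"
  proof (rule ccontr)
    assume "x \<notin> {x. j (fst x) \<le> ereal (snd x)}"
    then obtain s where s: "ereal (snd x) < ereal s" "ereal s < j (fst x)"
      using ereal_dense2[of "ereal (snd x)" "j (fst x)"] by (auto simp: not_le)
    note s(2)
    also have "j (fst x) \<le> Liminf (at (fst x)) j"
      using assms by (simp add: lower_semicontinuous_def)
    finally have "eventually (\<lambda>v. ereal s < j v) (at (fst x))" by (rule less_LiminfD)
    \<comment> \<open>The limit inferior over \<open>at\<close> ignores the point itself, which the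
      sequence may hit; the value there is supplied by \<open>s(2)\<close>.\<close>
    then have "eventually (\<lambda>v. ereal s < j v) (nhds (fst x))"
      using s(2) by (auto simp: eventually_at_filter elim!: eventually_mono)
    then have "eventually (\<lambda>n. ereal s < j (fst (X n))) sequentially"
      using tendsto_fst[OF lim] by (auto simp: filterlim_iff)
    moreover have "eventually (\<lambda>n. snd (X n) < s) sequentially"
      using tendsto_snd[OF lim] s(1) by (auto intro: order_tendstoD)
    ultimately have "eventually (\<lambda>n. False) sequentially"
    proof eventually_elim
      case (elim n)
      then have "j (fst (X n)) \<le> ereal (snd (X n))" using X by blast
      also have "\<dots> < ereal s" using elim by simp
      finally show False using elim by simp
    qed
    then show False by simp
  qed
qed

section \<open>Sublinear functionals and their support property\<close>

locale sublinear_functional =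
  fixes j :: "'a::{real_inner, complete_space} \<Rightarrow> ereal"
  assumes proper: "proper_fun j"
    and convex: "convex_fun j"
    and lsc: "lower_semicontinuous j"
    and homogeneous: "positively_homogeneous j"
begin

lemma not_MInf: "j v \<noteq> -\<infinity>"
  using proper by (simp add: proper_fun_def)

text \<open>Homogeneity covers positive factors only and does not exclude the value \<infinity> at
  0. Shrinking a point of the epigraph towards the origin and using closedness gives the upper
  bound.\<close>

lemma zero: "j 0 = 0"
proof -
  obtain v a where va: "j v = ereal a"
    using proper not_MInf unfolding proper_fun_def by (metis ereal_cases)
  define X where "X n = ((1 / real (Suc n)) *\<^sub>R v, (1 / real (Suc n)) * a)" for n
  have "j (fst (X n)) \<le> ereal (snd (X n))" for n
    using homogeneous va by (simp add: X_def positively_homogeneous_def)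
  moreover have "X \<longlonglongrightarrow> (0 *\<^sub>R v, 0 * a)"
    unfolding X_def by (intro tendsto_intros LIMSEQ_Suc[OF lim_1_over_n])
  ultimately have "j 0 \<le> 0"
    using closed_sequentially[OF closed_epigraph[OF lsc], of X "(0 *\<^sub>R v, 0 * a)"]
    by (simp add: zero_ereal_def)
  \<comment> \<open>A finite value equal to its double is 0.\<close>
  moreover have "j (2 *\<^sub>R 0) = ereal 2 * j 0"
    using homogeneous unfolding positively_homogeneous_def by (metis zero_less_numeral)
  ultimately show ?thesis using not_MInf[of 0] by (cases "j 0") auto
qed

lemma convex_cone_epigraph: "convex_cone {x. j (fst x) \<le> ereal (snd x)}"
  unfolding convex_cone_iff
proof (intro conjI ballI allI impI)
  show "0 \<in> {x. j (fst x) \<le> ereal (snd x)}" by (simp add: zero zero_ereal_def)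
next
  have scale: "j (c *\<^sub>R v) = ereal c * j v" if "c > 0" for c v
    using homogeneous that by (simp add: positively_homogeneous_def)
  {
    fix x y assume xy: "x \<in> {x. j (fst x) \<le> ereal (snd x)}" "y \<in> {x. j (fst x) \<le> ereal (snd x)}"
    obtain a b where ab: "j (fst x) = ereal a" "j (fst y) = ereal b"
      using xy not_MInf[of "fst x"] not_MInf[of "fst y"] by (cases "j (fst x)"; cases "j (fst y)") auto
    \<comment> \<open>Doubling the arguments absorbs the weights 1/2, so convexity becomes
      subadditivity.\<close>
    have "j ((1 - 1/2) *\<^sub>R (2 *\<^sub>R fst x) + (1/2) *\<^sub>R (2 *\<^sub>R fst y))
        \<le> ereal (1 - 1/2) * j (2 *\<^sub>R fst x) + ereal (1/2) * j (2 *\<^sub>R fst y)"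
      using convex unfolding convex_fun_def by (metis divide_le_eq_1_pos half_gt_zero_iff
          less_eq_real_def one_le_numeral zero_less_numeral zero_less_one)
    then have "j (fst x + fst y) \<le> ereal (a + b)"
      by (simp add: scale ab)
    also have "\<dots> \<le> ereal (snd x + snd y)"
      using xy ab by simp
    finally show "x + y \<in> {x. j (fst x) \<le> ereal (snd x)}" by simp
  }
  {
    fix x and c :: real assume x: "x \<in> {x. j (fst x) \<le> ereal (snd x)}" and c: "0 \<le> c"
    show "c *\<^sub>R x \<in> {x. j (fst x) \<le> ereal (snd x)}"
    proof (cases "c = 0")
      case True
      then show ?thesis by (simp add: zero zero_ereal_def)
    next
      case False
      then show ?thesis
        using x c not_MInf[of "fst x"] by (cases "j (fst x)") (auto simp: scale mult_left_mono)
    qed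
  }
qed

text \<open>The pair \<open>(a, - b)\<close> is the normal of a hyperplane separating
  \<open>(x, r)\<close> from the epigraph; \<open>b\<close> is nonnegative because
  \<open>(0, 1)\<close> lies in the epigraph.\<close>

lemma epigraph_separation:
  assumes "ereal r < j x"
  obtains a b where "b \<ge> 0" "\<And>v s. j v = ereal s \<Longrightarrow> a \<bullet> v \<le> b * s" "a \<bullet> x > b * r"
proof -
  have "(x, r) \<notin> {x. j (fst x) \<le> ereal (snd x)}" using assms by auto
  then obtain z where z: "\<And>v. v \<in> {x. j (fst x) \<le> ereal (snd x)} \<Longrightarrow> z \<bullet> v \<le> 0" "z \<bullet> (x, r) > 0"
    using convex_cone_separation[OF closed_epigraph[OF lsc] convex_cone_epigraph] by blast
  show thesis
  proof (rule that)
    show "- snd z \<ge> 0" using z(1)[of "(0, 1)"] by (simp add: zero inner_prod_def)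
    show "fst z \<bullet> v \<le> - snd z * s" if "j v = ereal s" for v s
      using z(1)[of "(v, s)"] that by (simp add: inner_prod_def)
    show "fst z \<bullet> x > - snd z * r" using z(2) by (simp add: inner_prod_def)
  qed
qed

lemma mem_subdiff0I:
  assumes "\<And>v s. j v = ereal s \<Longrightarrow> blinfun_apply p v \<le> s"
  shows "p \<in> subdiff0 j"
proof -
  have "ereal (p v) \<le> j v" for v
    using assms[of v] not_MInf[of v] by (cases "j v") auto
  then show ?thesis by (simp add: subdiff0_def)
qed

lemma subdiff0_of_separation:
  assumes "b > 0" "\<And>v s. j v = ereal s \<Longrightarrow> a \<bullet> v \<le> b * s"
  shows "blinfun_inner_left (a /\<^sub>R b) \<in> subdiff0 j"
  using assms by (intro mem_subdiff0I) (simp add: inner_commute field_simps)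

text \<open>Separating \<open>(0, -1)\<close> excludes a vertical hyperplane, since
  \<open>a \<bullet> 0 = 0\<close> forces \<open>b > 0\<close>.\<close>

lemma subdiff0_nonempty: "subdiff0 j \<noteq> {}"
proof -
  have "ereal (-1) < j 0" by (simp add: zero)
  then obtain a b where ab: "b \<ge> 0" "\<And>v s. j v = ereal s \<Longrightarrow> a \<bullet> v \<le> b * s" "a \<bullet> 0 > b * (-1)"
    by (rule epigraph_separation) blast
  then show ?thesis using subdiff0_of_separation[of b a] by auto
qed

text \<open>A vertical separating hyperplane (b = 0) is tilted by a large multiple of its normal
  added to some element of the subdifferential.\<close>

lemma subdiff0_support:
  assumes "ereal r < j x"
  shows "\<exists>p\<in>subdiff0 j. p x > r"
proof -
  obtain a b where ab: "b \<ge> 0" "\<And>v s. j v = ereal s \<Longrightarrow> a \<bullet> v \<le> b * s" "a \<bullet> x > b * r"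
    using epigraph_separation[OF assms] by metis
  show ?thesis
  proof (cases "b = 0")
    case False
    then have "b > 0" using ab by simp
    then show ?thesis
      using subdiff0_of_separation[OF _ ab(2)] ab(3)
      by (intro bexI[of _ "blinfun_inner_left (a /\<^sub>R b)"]) (auto simp: inner_commute field_simps)
  next
    case True
    obtain p where p: "p \<in> subdiff0 j" using subdiff0_nonempty by blast
    \<comment> \<open>Chosen so that the tilt raises the value at \<open>x\<close> by more than the
      gap \<open>r - p x\<close>.\<close>
    define t where "t = (\<bar>r - p x\<bar> + 1) / (a \<bullet> x)"
    have ax: "a \<bullet> x > 0" using ab True by simp
    have t: "t \<ge> 0" "t * (a \<bullet> x) = \<bar>r - p x\<bar> + 1" using ax by (auto simp: t_def)
    have "p + t *\<^sub>R blinfun_inner_left a \<in> subdiff0 j"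
    proof (rule mem_subdiff0I)
      fix v s assume s: "j v = ereal s"
      have "ereal (p v) \<le> j v" using p by (simp add: subdiff0_def)
      moreover have "t * (a \<bullet> v) \<le> 0" using ab(2)[OF s] True t by (simp add: mult_nonneg_nonpos)
      ultimately show "blinfun_apply (p + t *\<^sub>R blinfun_inner_left a) v \<le> s"
        using s by (simp add: blinfun.bilinear_simps inner_commute)
    qed
    moreover have "(p + t *\<^sub>R blinfun_inner_left a) x > r"
      using t(2) by (simp add: blinfun.bilinear_simps inner_commute)
    ultimately show ?thesis by blast
  qed
qed

end

section \<open>Primal and dual solutions\<close>

text \<open>The variational inequality on {v. f - A v \<in> K} for the adjoint form a*(u,v) = (A v)(u).\<close>

lemma dual_pair_exists:
  fixes A :: "'a::{real_inner, complete_space} \<Rightarrow>\<^sub>L ('a \<Rightarrow>\<^sub>L real)"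
  assumes c: "c > 0" "\<And>v. c * (norm v)\<^sup>2 \<le> A v v"
    and K: "closed K" "convex K" "K \<noteq> {}"
  shows "\<exists>y. f - A y \<in> K \<and> (\<forall>p\<in>K. (p - (f - A y)) y \<le> 0)"
proof -
  define K' where "K' = {v. f - A v \<in> K}"
  have surj: "\<exists>v. p = f - A v" for p
  proof -
    obtain v where "A v = f - p"
      using bij_is_surj[OF lax_milgram[OF c]] by (metis surjE)
    then show ?thesis by (intro exI[of _ v]) simp
  qed
  have "closed ((\<lambda>v. f - A v) -` K)"
    using K(1) by (intro closed_vimage continuous_intros)
  then have "closed K'" by (simp add: K'_def vimage_def)
  moreover have "convex K'"
  proof (rule convexI)
    fix x y and u w :: real
    assume *: "x \<in> K'" "y \<in> K'" "0 \<le> u" "0 \<le> w" "u + w = 1"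
    have "u *\<^sub>R (f - A x) + w *\<^sub>R (f - A y) \<in> K"
      using * K(2) by (intro convexD) (auto simp: K'_def)
    also have "u *\<^sub>R (f - A x) + w *\<^sub>R (f - A y) = (u + w) *\<^sub>R f - A (u *\<^sub>R x + w *\<^sub>R y)"
      by (simp add: algebra_simps blinfun.bilinear_simps)
    finally show "u *\<^sub>R x + w *\<^sub>R y \<in> K'" using * by (simp add: K'_def)
  qed
  moreover have "K' \<noteq> {}" using K(3) surj unfolding K'_def by (metis empty_iff ex_in_conv mem_Collect_eq)
  ultimately obtain y where y: "y \<in> K'" "\<forall>v\<in>K'. A (v - y) y \<ge> blinfun_apply 0 (v - y)"
    using stampacchia[OF bounded_bilinear.flip[OF bounded_bilinear_blinfun_apply2[of A]] c, of K' 0]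
    by blast
  have "(p - (f - A y)) y \<le> 0" if "p \<in> K" for p
  proof -
    obtain v where "p = f - A v" using surj by blast
    then show ?thesis using y(2) that by (auto simp: K'_def blinfun.bilinear_simps)
  qed
  then show ?thesis using y(1) by (auto simp: K'_def)
qed

text \<open>Both values of \<open>j\<close> are finite, so they cancel when the inequalities tested
  with each other's solution are added.\<close>

lemma solves_primal_unique:
  fixes A :: "'a::real_inner \<Rightarrow>\<^sub>L ('a \<Rightarrow>\<^sub>L real)"
  assumes c: "c > 0" "\<And>v. c * (norm v)\<^sup>2 \<le> A v v"
    and j: "proper_fun j" and y: "solves_primal A j f y" "solves_primal A j f y'"
  shows "y = y'"
proof -
  obtain a b where ab: "j y = ereal a" "j y' = ereal b"
    using solves_primal_finite[OF j y(1)] solves_primal_finite[OF j y(2)]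
    by (cases "j y"; cases "j y'") auto
  have "(A y - f) (y' - y) + b - a \<ge> 0" "(A y' - f) (y - y') + a - b \<ge> 0"
    using y(1)[unfolded solves_primal_def, rule_format, of y']
      y(2)[unfolded solves_primal_def, rule_format, of y] ab by simp_all
  then have "A (y - y') (y - y') \<le> 0"
    by (simp add: blinfun.bilinear_simps)
  with c(2)[of "y - y'"] have "c * (norm (y - y'))\<^sup>2 \<le> 0" by linarith
  then show ?thesis using c(1) by (simp add: mult_le_0_iff)
qed

text \<open>The support property forces \<open>j y = q y\<close>, as otherwise some subgradient
  would exceed \<open>q\<close> at \<open>y\<close>. The primal inequality then reduces to
  \<open>q v \<le> j v\<close>.\<close>

lemma (in sublinear_functional) solves_primal_if_dual_pair:
  fixes A :: "'a \<Rightarrow>\<^sub>L ('a \<Rightarrow>\<^sub>L real)"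
  assumes q: "f - A y \<in> subdiff0 j" "\<And>p. p \<in> subdiff0 j \<Longrightarrow> (p - (f - A y)) y \<le> 0"
  shows "solves_primal A j f y"
proof -
  define q where "q = f - A y"
  have qle: "ereal (q v) \<le> j v" for v
    using assms(1) by (simp add: subdiff0_def q_def)
  have "\<not> ereal (q y) < j y"
    using subdiff0_support[of "q y" y] assms(2) by (force simp: q_def blinfun.bilinear_simps)
  then have jy: "j y = ereal (q y)" using qle[of y] by (simp add: antisym)
  have "A y - f = - q" by (simp add: q_def)
  then show ?thesis
    unfolding solves_primal_def
  proof (intro allI)
    fix v
    show "0 \<le> ereal ((A y - f) (v - y)) + j v - j y"
      unfolding \<open>A y - f = - q\<close> jy using qle[of v] not_MInf[of v]
      by (cases "j v") (auto simp: blinfun.bilinear_simps)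
  qed
qed

lemma (in sublinear_functional) primal_sol_dual_pair:
  fixes A :: "'a \<Rightarrow>\<^sub>L ('a \<Rightarrow>\<^sub>L real)"
  assumes c: "c > 0" "\<And>v. c * (norm v)\<^sup>2 \<le> A v v"
  shows "f - A (primal_sol A j f) \<in> subdiff0 j"
    and "\<forall>p\<in>subdiff0 j. (p - (f - A (primal_sol A j f))) (primal_sol A j f) \<le> 0"
proof -
  obtain y where y: "f - A y \<in> subdiff0 j" "\<forall>p\<in>subdiff0 j. (p - (f - A y)) y \<le> 0"
    using dual_pair_exists[OF c subdiff0_closed[OF not_MInf] subdiff0_convex[OF not_MInf]
        subdiff0_nonempty] by blast
  then have "solves_primal A j f y" by (intro solves_primal_if_dual_pair) auto
  then have "primal_sol A j f = y"
    unfolding primal_sol_def using solves_primal_unique[OF c proper] by (intro the_equality) auto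
  with y show "f - A (primal_sol A j f) \<in> subdiff0 j"
    "\<forall>p\<in>subdiff0 j. (p - (f - A (primal_sol A j f))) (primal_sol A j f) \<le> 0"
    by auto
qed

text \<open>By surjectivity every candidate is \<open>f - A v\<close>, and the inverse of
  \<open>A\<close> sends its difference from \<open>f\<close> to \<open>- v\<close>. The dual
  problem thus becomes the same normal cone condition, and coercivity gives uniqueness.\<close>

lemma dual_sol_eq:
  fixes A :: "'a::{real_inner, complete_space} \<Rightarrow>\<^sub>L ('a \<Rightarrow>\<^sub>L real)"
  assumes c: "c > 0" "\<And>v. c * (norm v)\<^sup>2 \<le> A v v"
    and y: "f - A y \<in> subdiff0 j" "\<forall>p\<in>subdiff0 j. (p - (f - A y)) y \<le> 0"
  shows "dual_sol A j f = f - A y"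
proof -
  have bij: "bij (blinfun_apply A)" by (rule lax_milgram[OF c])
  have solves: "solves_dual A j f (f - A v) \<longleftrightarrow>
      f - A v \<in> subdiff0 j \<and> (\<forall>p\<in>subdiff0 j. (p - (f - A v)) v \<le> 0)" for v
  proof -
    have "inv (blinfun_apply A) (f - A v - f) = - v"
      using inv_f_f[OF bij_is_inj[OF bij], of "- v"] by (simp add: blinfun.bilinear_simps)
    then show ?thesis by (simp add: solves_dual_def blinfun.bilinear_simps)
  qed
  show ?thesis
    unfolding dual_sol_def
  proof (rule the_equality)
    show "solves_dual A j f (f - A y)" using y by (simp add: solves)
  next
    fix q assume q: "solves_dual A j f q"
    obtain v where "A v = f - q" using bij_is_surj[OF bij] by (metis surjE)
    then have v: "q = f - A v" by simp
    have "(f - A y - (f - A v)) v \<le> 0" "(f - A v - (f - A y)) y \<le> 0"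
      using q y unfolding v solves by blast+
    then have "A (v - y) (v - y) \<le> 0" by (simp add: blinfun.bilinear_simps)
    with c(2)[of "v - y"] have "c * (norm (v - y))\<^sup>2 \<le> 0" by linarith
    then show "q = f - A y" using c(1) v by (simp add: mult_le_0_iff)
  qed
qed


section \<open>Directional differentiability\<close>

text \<open>Testing with \<open>d + v\<close> puts the residual in the polar of the cone
  \<open>critical_polar K q y\<close>. Separation yields tangency, the elements \<open>y\<close> and
  \<open>- y\<close> give orthogonality to \<open>y\<close>, and the test vector 0 gives
  complementarity.\<close>

lemma critical_vi_residual:
  fixes A :: "'a::{real_inner, complete_space} \<Rightarrow>\<^sub>L ('a \<Rightarrow>\<^sub>L real)"
  assumes K: "convex K" "q \<in> K"
    and d: "d \<in> critical_polar K q y"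
      "\<And>v. v \<in> critical_polar K q y \<Longrightarrow> (A d - g) (v - d) \<ge> 0"
  shows "g - A d \<in> tangent_cone K q" "(g - A d) y = 0" "(g - A d) d = 0"
proof -
  note cone = convex_cone_critical_polar[of K q y]
  have le: "(g - A d) v \<le> 0" if "v \<in> critical_polar K q y" for v
    using d(2)[OF convex_cone_add[OF cone d(1) that]] by (simp add: blinfun.bilinear_simps)
  show "g - A d \<in> tangent_cone K q"
  proof (rule ccontr)
    assume not: "g - A d \<notin> tangent_cone K q"
    obtain v where "\<And>p. p \<in> tangent_cone K q \<Longrightarrow> p v \<le> 0" "(g - A d) v > 0"
      by (rule convex_cone_separation_dual[OF _ _ not])
         (auto simp: tangent_cone_def K convex_cone_closure convex_cone_radial_cone)
    then show False using le[of v] by (simp add: mem_critical_polar)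
  qed
  have "y \<in> critical_polar K q y" "- y \<in> critical_polar K q y"
    by (auto simp: mem_critical_polar blinfun.bilinear_simps)
  from le[OF this(1)] le[OF this(2)] show "(g - A d) y = 0"
    by (simp add: blinfun.bilinear_simps)
  show "(g - A d) d = 0"
    using le[OF d(1)] d(2)[OF convex_cone_contains_0[OF cone]]
    by (simp add: blinfun.bilinear_simps)
qed

text \<open>Here \<open>e\<close> and \<open>g - A e\<close> are the difference quotients of the primal and the dual solution.\<close>

lemma difference_quotient_estimates:
  fixes A :: "'a::real_inner \<Rightarrow>\<^sub>L ('a \<Rightarrow>\<^sub>L real)"
  assumes c: "c > 0" "\<And>v. c * (norm v)\<^sup>2 \<le> A v v" and t: "t > 0"
    and y: "f - A y \<in> K" "\<forall>p\<in>K. (p - (f - A y)) y \<le> 0"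
    and e: "f + t *\<^sub>R g - A (y + t *\<^sub>R e) \<in> K"
      "\<forall>p\<in>K. (p - (f + t *\<^sub>R g - A (y + t *\<^sub>R e))) (y + t *\<^sub>R e) \<le> 0"
  shows "c * norm e \<le> norm g"
    and "g - A e \<in> radial_cone K (f - A y)"
    and "(g - A e) y \<le> 0"
    and "\<And>h. blinfun_apply h y = 0 \<Longrightarrow> f - A y + t *\<^sub>R h \<in> K \<Longrightarrow> t * (h - (g - A e)) e \<le> (g - A e) y"
proof -
  define \<psi> where "\<psi> = g - A e"
  have q': "f + t *\<^sub>R g - A (y + t *\<^sub>R e) = f - A y + t *\<^sub>R \<psi>"
    by (simp add: \<psi>_def blinfun.bilinear_simps algebra_simps)
  note e = e[unfolded q']
  have "(1 / t) *\<^sub>R (f - A y + t *\<^sub>R \<psi> - (f - A y)) \<in> radial_cone K (f - A y)"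
    using t e(1) by (intro radial_coneI) auto
  also have "(1 / t) *\<^sub>R (f - A y + t *\<^sub>R \<psi> - (f - A y)) = \<psi>"
    using t by simp
  finally show "g - A e \<in> radial_cone K (f - A y)" by (simp add: \<psi>_def)
  \<comment> \<open>The unperturbed problem is tested with the perturbed dual solution.\<close>
  have "t * \<psi> y \<le> 0"
    using bspec[OF y(2) e(1)] by (simp add: blinfun.bilinear_simps)
  then have \<psi>y: "\<psi> y \<le> 0" using t by (simp add: mult_le_0_iff)
  then show "(g - A e) y \<le> 0" by (simp add: \<psi>_def)
  \<comment> \<open>The roles are exchanged; together both tests give
    \<open>\<psi> e \<ge> 0\<close>, the monotonicity behind the Lipschitz bound.\<close>
  have "t * \<psi> (y + t *\<^sub>R e) \<ge> 0"
    using bspec[OF e(2) y(1)] by (simp add: blinfun.bilinear_simps algebra_simps)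
  then have "\<psi> y + t * \<psi> e \<ge> 0"
    using t by (simp add: blinfun.bilinear_simps zero_le_mult_iff)
  then have "t * \<psi> e \<ge> 0" using \<psi>y by linarith
  then have "A e e \<le> g e" using t by (simp add: \<psi>_def zero_le_mult_iff blinfun.bilinear_simps)
  also have "\<dots> \<le> norm g * norm e" using norm_blinfun[of g e] by simp
  finally have "c * (norm e)\<^sup>2 \<le> norm g * norm e" using c(2)[of e] by linarith
  then show "c * norm e \<le> norm g"
    by (cases "norm e = 0") (auto simp: power2_eq_square mult_le_cancel_right mult.assoc[symmetric])
  show "t * (h - (g - A e)) e \<le> (g - A e) y" if h: "blinfun_apply h y = 0" "f - A y + t *\<^sub>R h \<in> K" for h
  proof -
    have "t * (h - \<psi>) (y + t *\<^sub>R e) \<le> 0"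
      using bspec[OF e(2) h(2)] by (simp add: blinfun.bilinear_simps algebra_simps)
    then have "(h - \<psi>) (y + t *\<^sub>R e) \<le> 0" using t by (simp add: mult_le_0_iff)
    then show ?thesis using h(1) by (simp add: \<psi>_def[symmetric] blinfun.bilinear_simps)
  qed
qed

text \<open>The map \<open>S\<close> enters only through its normal cone conditions. All
  approximations are fixed for a given \<epsilon> before \<open>n\<close> tends to infinity.\<close>

lemma hadamard_derivative_solution_map:
  fixes A :: "'a::{real_inner, complete_space} \<Rightarrow>\<^sub>L ('a \<Rightarrow>\<^sub>L real)"
  assumes c: "c > 0" "\<And>v. c * (norm v)\<^sup>2 \<le> A v v" and K: "convex K"
    and S: "\<And>f. f - A (S f) \<in> K" "\<And>f. \<forall>p\<in>K. (p - (f - A (S f))) (S f) \<le> 0"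
    and q: "q = f - A (S f)"
    and poly: "polyhedric_at K q (bidual_embed (S f))"
    and d: "d \<in> critical_polar K q (S f)"
      "\<And>v. v \<in> critical_polar K q (S f) \<Longrightarrow> (A d - g) (v - d) \<ge> 0"
  shows "has_hadamard_derivative S f g d"
  unfolding has_hadamard_derivative_def
proof (intro allI impI)
  fix t :: "nat \<Rightarrow> real" and G
  assume t: "\<forall>n. t n > 0" "t \<longlonglongrightarrow> 0" and G: "G \<longlonglongrightarrow> g"
  define y where "y = S f"
  define e where "e n = (S (f + t n *\<^sub>R G n) - S f) /\<^sub>R t n" for n
  define \<psi> where "\<psi> n = G n - A (e n)" for n
  define \<zeta> where "\<zeta> = g - A d"
  have qK: "q \<in> K" using S(1) q by simp
  have qy: "q = f - A y" by (simp add: q y_def)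
  have tpos: "t n > 0" for n using t by simp
  have step: "S (f + t n *\<^sub>R G n) = y + t n *\<^sub>R e n" for n
    using tpos[of n] by (simp add: e_def y_def)
  note est = difference_quotient_estimates[where t = "t n" and e = "e n" and g = "G n" for n,
      OF c tpos S(1)[of f, folded y_def] S(2)[of f, folded y_def]
        S(1)[of "f + t n *\<^sub>R G n" for n, unfolded step]
        S(2)[of "f + t n *\<^sub>R G n" for n, unfolded step], folded qy \<psi>_def]
  note \<zeta> = critical_vi_residual[OF K qK d, folded \<zeta>_def y_def]
  obtain M where M: "\<And>n. norm (G n) \<le> M"
    using Bseq_eq_bounded convergent_imp_Bseq[OF convergentI[OF G]] by (metis BseqE)
  define R where "R = M / c"
  have eR: "norm (e n) \<le> R" for n
    using est(1)[of n] M[of n] c(1) by (simp add: R_def field_simps)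
  have R0: "R \<ge> 0" using eR[of 0] norm_ge_zero order_trans by blast
  define L where "L = M + norm A * R"
  have \<psi>L: "norm (\<psi> n) \<le> L" for n
  proof -
    have "norm (\<psi> n) \<le> norm (G n) + norm (A (e n))"
      unfolding \<psi>_def by (rule norm_triangle_ineq4)
    also have "\<dots> \<le> M + norm A * norm (e n)"
      by (intro add_mono M norm_blinfun)
    also have "\<dots> \<le> L" unfolding L_def by (intro add_left_mono mult_left_mono eR) auto
    finally show ?thesis .
  qed
  have L0: "L \<ge> 0" using \<psi>L[of 0] norm_ge_zero order_trans by blast
  have \<psi>T: "\<psi> n \<in> tangent_cone K q" for n
    using est(2) radial_cone_subset_tangent_cone by blast

  have lim: "eventually (\<lambda>n. A (e n - d) (e n - d) < \<epsilon> * (R + L + 1)) sequentially"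
    if \<epsilon>: "\<epsilon> > 0" for \<epsilon>
  proof -
    \<comment> \<open>Polyhedricity enters here.\<close>
    have "\<zeta> \<in> closure (radial_cone K q \<inter> annihilator (bidual_embed y))"
      using \<zeta>(1,2) poly unfolding polyhedric_at_def y_def[symmetric]
      by (auto simp: annihilator_def)
    then obtain h where h: "h \<in> radial_cone K q" "h y = 0" "norm (\<zeta> - h) < \<epsilon>"
      using \<epsilon> by (auto simp: closure_approachable annihilator_def dist_norm norm_minus_commute)
    obtain \<tau> where \<tau>: "\<tau> > 0" "\<And>s. 0 \<le> s \<Longrightarrow> s \<le> \<tau> \<Longrightarrow> q + s *\<^sub>R h \<in> K"
      using radial_cone_add_mem[OF K qK h(1)] by metis
    have dpol: "p d \<le> 0" if "p \<in> tangent_cone K q" "p y = 0" for p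
      using d(1) that by (simp add: mem_critical_polar y_def)
    \<comment> \<open>The size and sign of \<open>s\<close> are uncontrolled, but \<open>s\<close>
      does not depend on \<open>n\<close>, so the factor \<open>t n\<close> will absorb it.\<close>
    obtain \<eta> s where \<eta>: "\<And>p. p \<in> tangent_cone K q \<Longrightarrow> p \<eta> \<le> 0"
      and \<eta>d: "norm (d - (\<eta> + s *\<^sub>R y)) < \<epsilon>"
    proof (rule polar_Int_annihilator_approx[OF _ _ dpol \<epsilon>])
      show "closed (tangent_cone K q)" "convex_cone (tangent_cone K q)"
        by (simp_all add: tangent_cone_def K qK convex_cone_closure convex_cone_radial_cone)
    qed auto
    define B where
      "B n = norm (G n - g) * (R + norm d) + \<epsilon> * (R + L) + \<bar>s\<bar> * (t n * ((norm h + L) * R))" for n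
    have bound: "A (e n - d) (e n - d) \<le> B n" if tn: "t n \<le> \<tau>" for n
    proof -
      have lower: "t n * (h - \<psi> n) (e n) \<le> \<psi> n y"
        using est(4)[OF h(2), of n] \<tau>(2)[of "t n"] tn tpos[of n] by simp
      have \<psi>y: "\<psi> n y \<le> 0" by (rule est(3))
      have "t n * (h - \<psi> n) (e n) \<le> 0" using lower \<psi>y by linarith
      then have 1: "(h - \<psi> n) (e n) \<le> 0" using tpos[of n] by (simp only: mult_le_0_iff) linarith
      \<comment> \<open>Both sides of \<open>lower\<close> are nonpositive, so taking absolute
        values reverses it; hence \<open>\<psi> n y\<close> is of order \<open>t n\<close>.\<close>
      have "\<bar>\<psi> n y\<bar> \<le> t n * \<bar>(h - \<psi> n) (e n)\<bar>"
        using lower unfolding abs_of_nonpos[OF 1] abs_of_nonpos[OF \<psi>y] by linarith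
      moreover have "\<bar>(h - \<psi> n) (e n)\<bar> \<le> (norm h + L) * R"
      proof -
        have "\<bar>(h - \<psi> n) (e n)\<bar> \<le> norm (h - \<psi> n) * norm (e n)"
          using norm_blinfun[of "h - \<psi> n" "e n"] by simp
        also have "\<dots> \<le> (norm h + L) * R"
          using norm_triangle_ineq4[of h "\<psi> n"] \<psi>L[of n] eR[of n] L0
          by (intro mult_mono) auto
        finally show ?thesis .
      qed
      ultimately have "\<bar>\<psi> n y\<bar> \<le> t n * ((norm h + L) * R)"
        using tpos[of n] by (meson less_imp_le mult_left_mono order_trans)
      then have "\<bar>s\<bar> * \<bar>\<psi> n y\<bar> \<le> \<bar>s\<bar> * (t n * ((norm h + L) * R))"
        by (intro mult_left_mono) auto
      then have 2: "s * \<psi> n y \<le> \<bar>s\<bar> * (t n * ((norm h + L) * R))"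
        using abs_ge_self[of "s * \<psi> n y"] by (simp add: abs_mult)
      have "\<psi> n (d - (\<eta> + s *\<^sub>R y)) \<le> L * \<epsilon>"
      proof -
        have "\<psi> n (d - (\<eta> + s *\<^sub>R y)) \<le> norm (\<psi> n) * norm (d - (\<eta> + s *\<^sub>R y))"
          using norm_blinfun[of "\<psi> n" "d - (\<eta> + s *\<^sub>R y)"] by simp
        also have "\<dots> \<le> L * \<epsilon>"
          using \<psi>L L0 \<eta>d by (intro mult_mono) auto
        finally show ?thesis .
      qed
      \<comment> \<open>In the splitting of \<open>d\<close>, the part \<open>\<eta>\<close>
        contributes a nonpositive term because \<open>\<psi> n\<close> is tangential.\<close>
      then have 3: "\<psi> n d \<le> L * \<epsilon> + s * \<psi> n y"
        using \<eta>[OF \<psi>T[of n]] by (simp add: blinfun.bilinear_simps)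
      have 4: "(\<zeta> - h) (e n) \<le> \<epsilon> * R"
      proof -
        have "(\<zeta> - h) (e n) \<le> norm (\<zeta> - h) * norm (e n)"
          using norm_blinfun[of "\<zeta> - h" "e n"] by simp
        also have "\<dots> \<le> \<epsilon> * R"
          using h(3) eR \<epsilon> by (intro mult_mono) auto
        finally show ?thesis .
      qed
      have 5: "(G n - g) (e n - d) \<le> norm (G n - g) * (R + norm d)"
      proof -
        have "(G n - g) (e n - d) \<le> norm (G n - g) * norm (e n - d)"
          using norm_blinfun[of "G n - g" "e n - d"] by simp
        also have "\<dots> \<le> norm (G n - g) * (R + norm d)"
          using eR[of n] norm_triangle_ineq4[of "e n" d] by (intro mult_left_mono) auto
        finally show ?thesis .
      qed
      \<comment> \<open>The pairing of \<open>\<zeta> - \<psi> n\<close> with \<open>e n - d\<close>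
        is expanded with \<open>h\<close> inserted; the first summand is the perturbation
        error.\<close>
      have "A (e n - d) (e n - d)
          = (G n - g) (e n - d) + (h - \<psi> n) (e n) + (\<zeta> - h) (e n) + \<psi> n d - \<zeta> d"
        by (simp add: \<psi>_def \<zeta>_def blinfun.bilinear_simps)
      then show ?thesis
        using 1 2 3 4 5 \<zeta>(3) unfolding B_def by (simp add: algebra_simps)
    qed
    \<comment> \<open>The limit is \<open>\<epsilon> * (R + L)\<close>; the summand 1 in the target
      bound supplies the strict gap.\<close>
    have "B \<longlonglongrightarrow> norm (g - g) * (R + norm d) + \<epsilon> * (R + L) + \<bar>s\<bar> * (0 * ((norm h + L) * R))"
      unfolding B_def by (intro tendsto_intros G t)
    then have "eventually (\<lambda>n. B n < \<epsilon> * (R + L + 1)) sequentially"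
      using \<epsilon> by (intro order_tendstoD(2)) (auto simp: algebra_simps)
    moreover have "eventually (\<lambda>n. t n < \<tau>) sequentially"
      using t(2) \<tau>(1) by (rule order_tendstoD(2))
    ultimately show ?thesis
    proof eventually_elim
      case (elim n)
      then show ?case using bound[of n] by simp
    qed
  qed
  have "e \<longlonglongrightarrow> d"
  proof (rule tendstoI)
    fix r :: real assume r: "r > 0"
    \<comment> \<open>With this choice the bound equals \<open>c * r\<^sup>2\<close>, and coercivity
      turns it into a distance below \<open>r\<close>.\<close>
    define \<epsilon> where "\<epsilon> = c * r\<^sup>2 / (R + L + 1)"
    have pos: "R + L + 1 > 0" using R0 L0 by simp
    have "\<epsilon> > 0" "\<epsilon> * (R + L + 1) = c * r\<^sup>2"
      using c(1) r pos by (auto simp: \<epsilon>_def)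
    with lim[of \<epsilon>] have "eventually (\<lambda>n. A (e n - d) (e n - d) < c * r\<^sup>2) sequentially"
      by simp
    then show "eventually (\<lambda>n. dist (e n) d < r) sequentially"
    proof eventually_elim
      case (elim n)
      with c(2)[of "e n - d"] have "c * (norm (e n - d))\<^sup>2 < c * r\<^sup>2" by linarith
      then have "(norm (e n - d))\<^sup>2 < r\<^sup>2" using c(1) by simp
      then show ?case using r by (simp add: dist_norm power2_less_imp_less)
    qed
  qed
  then show "(\<lambda>n. (S (f + t n *\<^sub>R G n) - S f) /\<^sub>R t n) \<longlonglongrightarrow> d"
    by (simp add: e_def[abs_def])
qed

theorem theorem2p3:
  fixes A :: "'a::{real_inner, complete_space} \<Rightarrow>\<^sub>L ('a \<Rightarrow>\<^sub>L real)"
    and j :: "'a \<Rightarrow> ereal"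
    and f :: "'a \<Rightarrow>\<^sub>L real"
    and y :: 'a
    and q :: "'a \<Rightarrow>\<^sub>L real"
  assumes "coercive A"
    and "proper_fun j"
    and "convex_fun j"
    and "lower_semicontinuous j"
    and "positively_homogeneous j"
    and "y = primal_sol A j f"
    and "q = dual_sol A j f"
    and "polyhedric_at (subdiff0 j) q (bidual_embed y)"
  shows "\<forall>g. \<exists>\<delta>. has_hadamard_derivative (primal_sol A j) f g \<delta> \<and>
           (\<forall>d. (d \<in> critical_polar (subdiff0 j) q y \<and>
                 (\<forall>v \<in> critical_polar (subdiff0 j) q y.
                    blinfun_apply (blinfun_apply A d - g) (v - d) \<ge> 0))
                \<longleftrightarrow> d = \<delta>)"
proof
  fix g :: "'a \<Rightarrow>\<^sub>L real"
  interpret sublinear_functional j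
    using assms by unfold_locales
  obtain c where c: "c > 0" "\<And>v. c * (norm v)\<^sup>2 \<le> A v v"
    using assms(1) by (auto simp: coercive_def)
  note S = primal_sol_dual_pair[OF c]
  have q: "q = f - A (primal_sol A j f)"
    using dual_sol_eq[OF c S] assms(7) by simp
  let ?P = "critical_polar (subdiff0 j) q y"
  note bil = bounded_bilinear_blinfun_apply2[of A]
  note P = convex_cone_critical_polar[of "subdiff0 j" q y]
  \<comment> \<open>The candidate derivative is obtained directly by solving the limiting inequality
    on a closed convex cone, before any difference quotient is considered.\<close>
  obtain d where d: "d \<in> ?P" "\<forall>v\<in>?P. A d (v - d) \<ge> g (v - d)"
    using stampacchia[OF bil c closed_critical_polar, of "subdiff0 j" q y g] P
    by (auto simp: convex_cone_def)
  have d': "(A d - g) (v - d) \<ge> 0" if "v \<in> ?P" for v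
    using bspec[OF d(2) that] by (simp add: blinfun.diff_left)
  have "has_hadamard_derivative (primal_sol A j) f g d"
    using assms(6,8) d(1) d'
    by (intro hadamard_derivative_solution_map[OF c subdiff0_convex[OF not_MInf] S q]) auto
  moreover have "d1 = d" if "d1 \<in> ?P" "\<forall>v\<in>?P. (A d1 - g) (v - d1) \<ge> 0" for d1
    using coercive_vi_unique[OF bil c, where u = d1 and u' = d and l = g] that d
    by (auto simp: blinfun.diff_left)
  ultimately show "\<exists>\<delta>. has_hadamard_derivative (primal_sol A j) f g \<delta> \<and>
      (\<forall>d. (d \<in> ?P \<and> (\<forall>v\<in>?P. (A d - g) (v - d) \<ge> 0)) \<longleftrightarrow> d = \<delta>)"
    using d(1) d' by blast
qed

end
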